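(* Let $x$ be a real number with $|x|\le 1$, put $a=\arcsin x$, and for integers $n\ge 0$, $q\ge 1$ let $I_q^{(n)}(x)=\int_0^x t^n(\arcsin t)^q\,dt$. Then for all integers $p\ge 0$, and all integers $\ell\geq 0$ in the first identity, respectively all integers $\ell\ge 1$ in the second, \begin{align*} I_{2p+1}^{(2\ell)}(x)&=\frac{x^{2\ell+1}}{2\ell+1}a^{2p+1} +\frac{(-1)^p(2p+1)!}{4^\ell(2\ell+1)}\sum_{k=0}^\ell\binom{2\ell+1}{\ell-k} \frac{1}{(2k+1)^{2p+1}}\\ &\quad\times\left(s_{p-1}((2k+1)a)T_{2k+1}(x) +c_p((2k+1)a)U_{2k}(x)\sqrt{1-x^2}-(-1)^k\right),\\ I_{2p+1}^{(2\ell-1)}(x) &=\left(x^{2\ell}-\frac{\binom{2\ell}{\ell}}{4^\ell}\right) \frac{a^{2p+1}}{2\ell} +\frac{(-1)^p(2p+1)!}{2^{2\ell-1}2\ell}\sum_{k=1}^\ell\binom{2\ell}{\ell-k} \frac{1}{(2k)^{2p+1}}\\ &\quad\times\left(s_{p-1}(2ka)T_{2k}(x)+c_p(2ka)U_{2k-1}(x)\sqrt{1-x^2}\right). \end{align*} Moreover, for all integers $p\geq 1$, and all integers $\ell\ge 0$ in the first identity, respectively all integers $\ell\ge 1$ in the second, \begin{align*} I_{2p}^{(2\ell)}(x)&=\frac{x^{2\ell+1}}{2\ell+1}a^{2p} +\frac{(-1)^p(2p)!}{4^\ell(2\ell+1)}\sum_{k=0}^\ell\binom{2\ell+1}{\ell-k}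 \frac{1}{(2k+1)^{2p}}\\ &\quad\times\left(c_{p-1}((2k+1)a)T_{2k+1}(x) -s_{p-1}((2k+1)a)U_{2k}(x)\sqrt{1-x^2}\right),\\ I_{2p}^{(2\ell-1)}(x) &=\left(x^{2\ell}-\frac{\binom{2\ell}{\ell}}{4^\ell}\right)\frac{a^{2p}}{2\ell} +\frac{(-1)^p(2p)!}{2^{2\ell-1}2\ell}\sum_{k=1}^\ell\binom{2\ell}{\ell-k} \frac{1}{(2k)^{2p}}\\ &\quad\times\left(c_{p-1}(2ka)T_{2k}(x) -s_{p-1}(2ka)U_{2k-1}(x)\sqrt{1-x^2}-(-1)^k\right). \end{align*}
   Context: $T_n$ and $U_n$ are the Chebyshev polynomials of the first and second kind, defined by $T_n(\cos\theta)=\cos(n\theta)$ and $U_n(\cos\theta)=\sin((n+1)\theta)/\sin\theta$. For integers $n\ge 0$, $c_n(z)=\sum_{j=0}^n(-1)^j\frac{z^{2j}}{(2j)!}$ and $s_n(z)=\sum_{j=0}^n(-1)^j\frac{z^{2j+1}}{(2j+1)!}$ are the partial sums of the Maclaurin series of cosine and sine; by convention $s_{-1}(z)=0$. *)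

theory Defs
  imports "HOL-Analysis.Analysis" "HOL-Computational_Algebra.Polynomial"
begin

definition cheb_T :: "nat \<Rightarrow> real poly" where
  "cheb_T n = (THE p. \<forall>\<theta>. poly p (cos \<theta>) = cos (real n * \<theta>))"

definition cheb_U :: "nat \<Rightarrow> real poly" where
  "cheb_U n = (THE p. \<forall>\<theta>. sin \<theta> \<noteq> 0 \<longrightarrow>
     poly p (cos \<theta>) = sin ((real n + 1) * \<theta>) / sin \<theta>)"

lemma cheb_exists:
  "\<exists>p q :: real poly. \<forall>\<theta>. poly p (cos \<theta>) = cos (real n * \<theta>) \<and>
     poly q (cos \<theta>) * sin \<theta> = sin (real n * \<theta>)"
proof (induction n)
  case 0
  show ?case by (intro exI[of _ 1] exI[of _ 0]) simp
next
  case (Suc n)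
  then obtain p q :: "real poly" where
    p: "\<And>\<theta>. poly p (cos \<theta>) = cos (real n * \<theta>)" and
    q: "\<And>\<theta>. poly q (cos \<theta>) * sin \<theta> = sin (real n * \<theta>)"
    by blast
  let ?p = "[:0, 1:] * p - (1 - [:0, 1:] * [:0, 1:]) * q" and ?q = "[:0, 1:] * q + p"
  have "poly ?p (cos \<theta>) = cos (real (Suc n) * \<theta>) \<and>
        poly ?q (cos \<theta>) * sin \<theta> = sin (real (Suc n) * \<theta>)" for \<theta>
  proof
    have "1 - cos \<theta> * cos \<theta> = sin \<theta> * sin \<theta>"
      using sin_cos_squared_add[of \<theta>] by (simp add: power2_eq_square)
    then have "poly ?p (cos \<theta>) = cos \<theta> * cos (real n * \<theta>) - sin \<theta> * (poly q (cos \<theta>) * sin \<theta>)"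
      by (simp add: p)
    then show "poly ?p (cos \<theta>) = cos (real (Suc n) * \<theta>)"
      unfolding q by (simp add: distrib_right cos_add)
    have "poly ?q (cos \<theta>) * sin \<theta> = cos \<theta> * (poly q (cos \<theta>) * sin \<theta>) + cos (real n * \<theta>) * sin \<theta>"
      by (simp add: p algebra_simps)
    then show "poly ?q (cos \<theta>) * sin \<theta> = sin (real (Suc n) * \<theta>)"
      unfolding q by (simp add: distrib_right sin_add)
  qed
  then show ?case by blast
qed

lemma poly_eq_if_eq_on_cos:
  fixes p q :: "real poly"
  assumes "\<And>\<theta>. sin \<theta> \<noteq> 0 \<Longrightarrow> poly p (cos \<theta>) = poly q (cos \<theta>)"
  shows "p = q"
proof (rule ccontr)
  assume "p \<noteq> q"
  then have "finite {x. poly (p - q) x = 0}" by (intro poly_roots_finite) simp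
  moreover have "{-1<..<1} \<subseteq> {x. poly (p - q) x = 0}"
  proof
    fix x :: real assume "x \<in> {-1<..<1}"
    then have "cos (arccos x) = x" "sin (arccos x) \<noteq> 0"
      by (simp_all add: sin_arccos_nonzero)
    with assms[of "arccos x"] show "x \<in> {x. poly (p - q) x = 0}" by simp
  qed
  ultimately have "finite {-1<..<(1::real)}" by (rule rev_finite_subset)
  then show False using infinite_Ioo[of "-1" "1::real"] by simp
qed

lemma poly_cheb_T_cos: "poly (cheb_T n) (cos \<theta>) = cos (real n * \<theta>)"
proof -
  have "\<exists>!p :: real poly. \<forall>\<theta>. poly p (cos \<theta>) = cos (real n * \<theta>)"
    using cheb_exists[of n] by (auto intro: poly_eq_if_eq_on_cos)
  from theI'[OF this] show ?thesis unfolding cheb_T_def by blast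
qed

lemma poly_cheb_U_cos:
  assumes "sin \<theta> \<noteq> 0"
  shows "poly (cheb_U n) (cos \<theta>) = sin ((real n + 1) * \<theta>) / sin \<theta>"
proof -
  let ?P = "\<lambda>p :: real poly. \<forall>\<theta>. sin \<theta> \<noteq> 0 \<longrightarrow> poly p (cos \<theta>) = sin ((real n + 1) * \<theta>) / sin \<theta>"
  obtain q :: "real poly" where "\<And>\<theta>. poly q (cos \<theta>) * sin \<theta> = sin (real (Suc n) * \<theta>)"
    using cheb_exists[of "Suc n"] by blast
  then have "?P q" by (simp add: eq_divide_eq add.commute)
  moreover have "p = q" if "?P p" for p
    using that \<open>?P q\<close> by (intro poly_eq_if_eq_on_cos) simp
  ultimately have "\<exists>!p. ?P p" by blast
  from theI'[OF this] show ?thesis using assms unfolding cheb_U_def by blast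
qed

definition cos_psum :: "nat \<Rightarrow> real \<Rightarrow> real" where
  "cos_psum n z = (\<Sum>j=0..n. (-1) ^ j * z ^ (2 * j) / fact (2 * j))"

text \<open>The index is an integer, so that the convention that the sum of index \<open>-1\<close> is \<open>0\<close>
  is the empty sum.\<close>
definition sin_psum :: "int \<Rightarrow> real \<Rightarrow> real" where
  "sin_psum n z = (\<Sum>j<nat (n + 1). (-1) ^ j * z ^ (2 * j + 1) / fact (2 * j + 1))"

lemma sin_psum_minus_one: "sin_psum (-1) z = 0"
  by (simp add: sin_psum_def)

lemma sin_psum_of_nat:
  "sin_psum (int n) z = (\<Sum>j=0..n. (-1) ^ j * z ^ (2 * j + 1) / fact (2 * j + 1))"
  unfolding sin_psum_def by (rule sum.cong) auto

text \<open>The interval integral is oriented, so this is the intended integral also for \<open>x < 0\<close>.\<close>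
definition arcsin_integral :: "nat \<Rightarrow> nat \<Rightarrow> real \<Rightarrow> real" where
  "arcsin_integral n q x = (LBINT t=0..x. t ^ n * arcsin t ^ q)"

end

theory Submission
  imports Defs
begin

text \<open>Substituting \<open>x = sin a\<close> turns the Chebyshev values into \<open>\<plusminus>sin (n a)\<close> and \<open>\<plusminus>cos (n a)\<close>.
  Integration by parts leaves the integral of a power of \<open>u\<close> times a power of \<open>sin u\<close>. The latter
  is expanded into multiple angles by the binomial theorem, and a primitive of a power of \<open>z\<close> times
  \<open>sin z\<close> or \<open>cos z\<close> is a combination of \<open>sin z\<close> and \<open>cos z\<close> whose coefficients are partial sums of
  the cosine and sine series: these partial sums are derivatives of each other up to one term.\<close>

section \<open>Multiple-angle expansions of powers of cosine and sine\<close>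

lemma cos_power_expansion:
  fixes t :: real
  shows "(2 * cos t) ^ n = (\<Sum>j\<le>n. real (n choose j) * cos ((2 * real j - real n) * t))"
proof -
  \<comment> \<open>The binomial theorem is applied in the complex numbers to
    \<open>2 * cos t = cis t + cis (- t)\<close>; the \<open>j\<close>-th term has frequency
    \<open>j - (n - j)\<close>, and real parts give the claim.\<close>
  have "complex_of_real ((2 * cos t) ^ n) = (cis t + cis (- t)) ^ n"
  proof -
    have "cis t + cis (- t) = complex_of_real (2 * cos t)"
      by (simp add: complex_eq_iff)
    then show ?thesis by simp
  qed
  also have "\<dots> = (\<Sum>j\<le>n. of_nat (n choose j) * cis ((2 * real j - real n) * t))"
    unfolding binomial_ring
  proof (rule sum.cong)
    fix j assume "j \<in> {..n}"
    then have "cis t ^ j * cis (- t) ^ (n - j) = cis ((2 * real j - real n) * t)"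
      by (simp only: Complex.DeMoivre cis_mult) (simp add: of_nat_diff algebra_simps)
    then show "of_nat (n choose j) * cis t ^ j * cis (- t) ^ (n - j)
        = of_nat (n choose j) * cis ((2 * real j - real n) * t)"
      by (simp add: mult.assoc)
  qed simp
  finally have "Re (complex_of_real ((2 * cos t) ^ n))
      = Re (\<Sum>j\<le>n. of_nat (n choose j) * cis ((2 * real j - real n) * t))"
    by (rule arg_cong)
  then show ?thesis
    unfolding Re_complex_of_real Re_sum by simp
qed

text \<open>The frequencies \<open>2 * j - (2 * l + 1)\<close> are odd and symmetric about 0. Since
  cosine is even and binomial coefficients are symmetric, the halves \<open>j \<le> l\<close> and
  \<open>j > l\<close> contribute equally; this doubling cancels one factor of
  \<open>2 ^ (2 * l + 1) = 2 * 4 ^ l\<close>.\<close>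

lemma cos_power_odd:
  fixes t :: real
  shows "cos t ^ (2 * l + 1)
    = 1 / 4 ^ l * (\<Sum>k=0..l. real ((2 * l + 1) choose (l - k)) * cos (real (2 * k + 1) * t))"
proof -
  let ?f = "\<lambda>j. real ((2 * l + 1) choose j) * cos ((2 * real j - real (2 * l + 1)) * t)"
  let ?S = "\<Sum>k=0..l. real ((2 * l + 1) choose (l - k)) * cos (real (2 * k + 1) * t)"
  have "sum ?f {..l} = ?S"
  proof (rule sum.reindex_bij_witness[of _ "\<lambda>k. l - k" "\<lambda>k. l - k"])
    fix j assume j: "j \<in> {..l}"
    then have "real (2 * (l - j) + 1) * t = - ((2 * real j - real (2 * l + 1)) * t)"
      by (simp add: of_nat_diff algebra_simps)
    then have "cos (real (2 * (l - j) + 1) * t) = cos ((2 * real j - real (2 * l + 1)) * t)"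
      by (metis cos_minus)
    with j show "real ((2 * l + 1) choose (l - (l - j))) * cos (real (2 * (l - j) + 1) * t) = ?f j"
      by simp
  qed auto
  moreover have "sum ?f {Suc l..2 * l + 1} = ?S"
  proof (rule sum.reindex_bij_witness[of _ "\<lambda>k. k + Suc l" "\<lambda>j. j - Suc l"])
    fix j assume j: "j \<in> {Suc l..2 * l + 1}"
    then have "(2 * l + 1) choose j = (2 * l + 1) choose (l - (j - Suc l))"
      by (subst binomial_symmetric) (auto intro: arg_cong2[where f = binomial])
    moreover from j have "real (2 * (j - Suc l) + 1) = 2 * real j - real (2 * l + 1)"
      by (simp add: of_nat_diff)
    ultimately show "real ((2 * l + 1) choose (l - (j - Suc l))) * cos (real (2 * (j - Suc l) + 1) * t) = ?f j"
      by (simp only:)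
  qed auto
  moreover have "{..2 * l + 1} = {..l} \<union> {Suc l..2 * l + 1}" by auto
  then have "sum ?f {..2 * l + 1} = sum ?f {..l} + sum ?f {Suc l..2 * l + 1}"
    by (simp only:) (rule sum.union_disjoint, auto)
  ultimately have "2 * ?S = (2 * cos t) ^ (2 * l + 1)"
    unfolding cos_power_expansion by simp
  also have "\<dots> = 2 * 4 ^ l * cos t ^ (2 * l + 1)"
    by (simp add: power_mult_distrib power_mult)
  finally have "?S = 4 ^ l * cos t ^ (2 * l + 1)"
    by (simp only: mult.assoc mult_cancel_left) simp
  then show ?thesis by (simp only:) simp
qed

text \<open>The terms pair up as for odd exponents, except that the middle one,
  \<open>j = l\<close>, has frequency 0 and yields the constant.\<close>

lemma cos_power_even:
  fixes t :: real
  shows "cos t ^ (2 * l) = real ((2 * l) choose l) / 4 ^ l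
    + 2 / 4 ^ l * (\<Sum>k=1..l. real ((2 * l) choose (l - k)) * cos (real (2 * k) * t))"
proof -
  let ?f = "\<lambda>j. real ((2 * l) choose j) * cos ((2 * real j - real (2 * l)) * t)"
  let ?S = "\<Sum>k=1..l. real ((2 * l) choose (l - k)) * cos (real (2 * k) * t)"
  have "sum ?f {..<l} = ?S"
  proof (rule sum.reindex_bij_witness[of _ "\<lambda>k. l - k" "\<lambda>k. l - k"])
    fix j assume j: "j \<in> {..<l}"
    then have "real (2 * (l - j)) * t = - ((2 * real j - real (2 * l)) * t)"
      by (simp add: of_nat_diff algebra_simps)
    then have "cos (real (2 * (l - j)) * t) = cos ((2 * real j - real (2 * l)) * t)"
      by (metis cos_minus)
    with j show "real ((2 * l) choose (l - (l - j))) * cos (real (2 * (l - j)) * t) = ?f j"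
      by simp
  qed auto
  moreover have "sum ?f {Suc l..2 * l} = ?S"
  proof (rule sum.reindex_bij_witness[of _ "\<lambda>k. k + l" "\<lambda>j. j - l"])
    fix j assume j: "j \<in> {Suc l..2 * l}"
    then have "(2 * l) choose j = (2 * l) choose (l - (j - l))"
      by (subst binomial_symmetric) (auto intro: arg_cong2[where f = binomial])
    moreover from j have "real (2 * (j - l)) = 2 * real j - real (2 * l)"
      by (simp add: of_nat_diff)
    ultimately show "real ((2 * l) choose (l - (j - l))) * cos (real (2 * (j - l)) * t) = ?f j"
      by (simp only:)
  qed auto
  moreover have "{..2 * l} = insert l ({..<l} \<union> {Suc l..2 * l})" by auto
  then have "sum ?f {..2 * l} = ?f l + sum ?f ({..<l} \<union> {Suc l..2 * l})"
    by simp
  moreover have "sum ?f ({..<l} \<union> {Suc l..2 * l}) = sum ?f {..<l} + sum ?f {Suc l..2 * l}"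
    by (rule sum.union_disjoint) auto
  ultimately have "(2 * cos t) ^ (2 * l) = real ((2 * l) choose l) + 2 * ?S"
    unfolding cos_power_expansion by simp
  moreover have "(2 * cos t) ^ (2 * l) = 4 ^ l * cos t ^ (2 * l)"
    by (simp add: power_mult_distrib power_mult)
  ultimately show ?thesis by (simp add: field_simps)
qed

text \<open>The angle is \<open>k * pi\<close> plus the complement of
  \<open>(2 * k + 1) * a\<close>: the multiple of \<open>pi\<close> gives the sign and the
  complement exchanges sine and cosine. An even multiple leaves no complement, so there the
  functions stay.\<close>

lemma cos_odd_complement:
  "cos (real (2 * k + 1) * (pi / 2 - a)) = (-1) ^ k * sin (real (2 * k + 1) * a)"
proof -
  have "real (2 * k + 1) * (pi / 2 - a) = real k * pi + (pi / 2 - real (2 * k + 1) * a)"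
    by (simp add: field_simps)
  then show ?thesis
    by (simp only: cos_add cos_diff sin_diff) (simp add: cos_npi)
qed

lemma sin_odd_complement:
  "sin (real (2 * k + 1) * (pi / 2 - a)) = (-1) ^ k * cos (real (2 * k + 1) * a)"
proof -
  have "real (2 * k + 1) * (pi / 2 - a) = real k * pi + (pi / 2 - real (2 * k + 1) * a)"
    by (simp add: field_simps)
  then show ?thesis
    by (simp only: sin_add cos_diff sin_diff) (simp add: cos_npi)
qed

lemma cos_even_complement:
  "cos (real (2 * k) * (pi / 2 - a)) = (-1) ^ k * cos (real (2 * k) * a)"
proof -
  have "real (2 * k) * (pi / 2 - a) = real k * pi - real (2 * k) * a"
    by (simp add: field_simps)
  then show ?thesis
    by (simp only: cos_diff) (simp add: cos_npi)
qed

lemma sin_even_complement: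
  "sin (real (2 * k) * (pi / 2 - a)) = - ((-1) ^ k * sin (real (2 * k) * a))"
proof -
  have "real (2 * k) * (pi / 2 - a) = real k * pi - real (2 * k) * a"
    by (simp add: field_simps)
  then show ?thesis
    by (simp only: sin_diff) (simp add: cos_npi)
qed

lemma sin_power_odd:
  fixes u :: real
  shows "sin u ^ (2 * l + 1) = 1 / 4 ^ l *
    (\<Sum>k=0..l. real ((2 * l + 1) choose (l - k)) * (-1) ^ k * sin (real (2 * k + 1) * u))"
  using cos_power_odd[of "pi / 2 - u" l]
  by (simp only: cos_odd_complement mult.assoc) (simp add: cos_diff)

lemma sin_power_even:
  fixes u :: real
  shows "sin u ^ (2 * l) = real ((2 * l) choose l) / 4 ^ l + 2 / 4 ^ l *
    (\<Sum>k=1..l. real ((2 * l) choose (l - k)) * (-1) ^ k * cos (real (2 * k) * u))"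
  using cos_power_even[of "pi / 2 - u" l]
  by (simp only: cos_even_complement mult.assoc) (simp add: cos_diff)

section \<open>Chebyshev polynomials at a sine\<close>

lemma poly_cheb_T_sin: "poly (cheb_T n) (sin a) = cos (real n * (pi / 2 - a))"
  using poly_cheb_T_cos[of n "pi / 2 - a"] by (simp add: sin_cos_eq)

text \<open>The product form, without division by \<open>cos a\<close>, holds also at
  \<open>sin a = 1\<close> and \<open>sin a = -1\<close>, that is, at the end points of the range of
  \<open>x\<close>.\<close>

lemma poly_cheb_U_sin:
  "poly (cheb_U n) (sin a) * cos a = sin (real (Suc n) * (pi / 2 - a))"
proof (cases "cos a = 0")
  case True
  \<comment> \<open>Any such \<open>q\<close> shows that
    \<open>sin (real (Suc n) * \<theta>)\<close> vanishes wherever \<open>sin \<theta>\<close> does,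
    so both sides are 0.\<close>
  obtain q :: "real poly" where "\<And>\<theta>. poly q (cos \<theta>) * sin \<theta> = sin (real (Suc n) * \<theta>)"
    using cheb_exists[of "Suc n"] by blast
  from this[of "pi / 2 - a"] True show ?thesis by (simp add: cos_sin_eq)
next
  case False
  have "sin (pi / 2 - a) = cos a" "cos (pi / 2 - a) = sin a"
    by (simp_all add: sin_diff cos_diff)
  with False show ?thesis
    using poly_cheb_U_cos[of "pi / 2 - a" n] by (simp add: add.commute)
qed

section \<open>Derivatives of the partial sums, and primitives built from them\<close>

lemma cos_psum_0 [simp]: "cos_psum n 0 = 1"
  by (simp add: cos_psum_def sum.atLeast_Suc_atMost power_0_left)

lemma sin_psum_0 [simp]: "sin_psum n 0 = 0"
  by (simp add: sin_psum_def)

text \<open>With the lower index written \<open>int n - 1\<close>, the case \<open>n = 0\<close>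
  starts from the empty sum and needs no separate treatment.\<close>

lemma sin_psum_Suc:
  "sin_psum (int n) z = sin_psum (int n - 1) z + (-1) ^ n * z ^ (2 * n + 1) / fact (2 * n + 1)"
proof -
  have "nat (int n + 1) = Suc n" "nat (int n - 1 + 1) = n" by simp_all
  then show ?thesis unfolding sin_psum_def by (simp only: sum.lessThan_Suc)
qed

lemma cos_psum_Suc:
  "cos_psum (Suc n) z = cos_psum n z + (-1) ^ Suc n * z ^ (2 * Suc n) / fact (2 * Suc n)"
  unfolding cos_psum_def by (simp only: sum.atLeast0_atMost_Suc)

lemma has_real_derivative_power_div_fact:
  "((\<lambda>z. c * z ^ Suc m / fact (Suc m)) has_real_derivative c * z ^ m / fact m) (at z)"
  by (rule derivative_eq_intros refl | simp)+

text \<open>The derivative is the cosine sum of index \<open>p - 1\<close>, written as the sum of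
  index \<open>p\<close> without its top term. This form covers \<open>p = 0\<close> and isolates
  the one term that survives in the primitives below.\<close>

lemma has_real_derivative_sin_psum':
  "(sin_psum (int p - 1) has_real_derivative
     cos_psum p z - (-1) ^ p * z ^ (2 * p) / fact (2 * p)) (at z)"
proof (induction p)
  case 0
  then show ?case by (simp add: sin_psum_def [abs_def] cos_psum_def)
next
  case (Suc p)
  have "(sin_psum (int p) has_real_derivative
     cos_psum p z - (-1) ^ p * z ^ (2 * p) / fact (2 * p) + (-1) ^ p * z ^ (2 * p) / fact (2 * p)) (at z)"
    unfolding sin_psum_Suc[abs_def] Suc_eq_plus1[symmetric]
    by (intro DERIV_add Suc has_real_derivative_power_div_fact)
  then show ?case unfolding cos_psum_Suc by (simp del: power_Suc fact_Suc)
qed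

lemma has_real_derivative_sin_psum:
  "(sin_psum (int p) has_real_derivative cos_psum p z) (at z)"
  using has_real_derivative_sin_psum'[of "Suc p" z] unfolding cos_psum_Suc by simp

text \<open>Differentiation kills the constant term and shifts the others, so the index drops by
  one; for \<open>p = 0\<close> the empty sine sum remains.\<close>

lemma has_real_derivative_cos_psum:
  "(cos_psum p has_real_derivative - sin_psum (int p - 1) z) (at z)"
proof (induction p)
  case 0
  then show ?case by (simp add: cos_psum_def [abs_def] sin_psum_def)
next
  case (Suc p)
  have e: "2 * Suc p = Suc (2 * p + 1)" by simp
  have "(cos_psum (Suc p) has_real_derivative
     - sin_psum (int p - 1) z + (-1) ^ Suc p * z ^ (2 * p + 1) / fact (2 * p + 1)) (at z)"
    unfolding cos_psum_Suc[abs_def] e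
    by (intro DERIV_add Suc has_real_derivative_power_div_fact)
  then show ?case using sin_psum_Suc[of p z] by simp
qed

text \<open>In the product rule everything cancels except the top term by which the derivative of
  the sine sum misses \<open>cos_psum p\<close>. The constant 1 is subtracted to make the primitive
  vanish at 0.\<close>

lemma primitive_power_even_sin:
  "((\<lambda>z. sin_psum (int p - 1) z * sin z + cos_psum p z * cos z - 1) has_real_derivative
     - ((-1) ^ p * z ^ (2 * p) / fact (2 * p) * sin z)) (at z)"
  by (rule derivative_eq_intros has_real_derivative_sin_psum' has_real_derivative_cos_psum refl)+
     (simp add: algebra_simps)

lemma primitive_power_even_cos:
  "((\<lambda>z. sin_psum (int p - 1) z * cos z - cos_psum p z * sin z) has_real_derivative
     - ((-1) ^ p * z ^ (2 * p) / fact (2 * p) * cos z)) (at z)"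
  by (rule derivative_eq_intros has_real_derivative_sin_psum' has_real_derivative_cos_psum refl)+
     (simp add: algebra_simps)

text \<open>Now both sums have index \<open>p\<close>, and what survives is the difference of two
  consecutive sine sums. The sign is written with \<open>Suc p\<close> because the power
  \<open>2 * p + 1\<close> serves the exponent \<open>2 * Suc p\<close> of arcsine.\<close>

lemma primitive_power_odd_sin:
  "((\<lambda>z. cos_psum p z * sin z - sin_psum (int p) z * cos z) has_real_derivative
     - ((-1) ^ Suc p * z ^ (2 * p + 1) / fact (2 * p + 1) * sin z)) (at z)"
  by (rule derivative_eq_intros has_real_derivative_sin_psum has_real_derivative_cos_psum refl)+
     (simp add: sin_psum_Suc[of p] algebra_simps del: fact_Suc)

lemma primitive_power_odd_cos:
  "((\<lambda>z. cos_psum p z * cos z + sin_psum (int p) z * sin z - 1) has_real_derivative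
     - ((-1) ^ Suc p * z ^ (2 * p + 1) / fact (2 * p + 1) * cos z)) (at z)"
  by (rule derivative_eq_intros has_real_derivative_sin_psum has_real_derivative_cos_psum refl)+
     (simp add: sin_psum_Suc[of p] algebra_simps del: fact_Suc)

section \<open>Substitution and integration by parts\<close>

text \<open>Under \<open>t = sin u\<close> the integrand becomes the derivative of \<open>G\<close>,
  so \<open>G\<close> composed with \<open>arcsin\<close> is a primitive of the original
  one.\<close>

lemma arcsin_integral_substitution:
  fixes G :: "real \<Rightarrow> real"
  assumes x: "\<bar>x\<bar> \<le> 1" and "G 0 = 0"
    and G: "\<And>u. (G has_real_derivative sin u ^ n * u ^ q * cos u) (at u)"
  shows "arcsin_integral n q x = G (arcsin x)"
proof -
  let ?f = "\<lambda>t::real. t ^ n * arcsin t ^ q"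
  \<comment> \<open>Both end points are kept general: the interval is from 0 to \<open>x\<close> for
    nonnegative \<open>x\<close>, and from \<open>x\<close> to 0, with reversed orientation, for
    negative \<open>x\<close>.\<close>
  have *: "(LBINT t=c..d. ?f t) = G (arcsin d) - G (arcsin c)"
    if cd: "-1 \<le> c" "c \<le> d" "d \<le> 1" for c d :: real
  proof -
    have sub: "{c..d} \<subseteq> {-1..1}" using cd by auto
    have cont: "continuous_on {c..d} arcsin"
      using continuous_on_arcsin' sub by (rule continuous_on_subset)
    have contG: "continuous_on {c..d} (\<lambda>t. G (arcsin t))"
      by (rule continuous_on_compose2[OF _ cont subset_UNIV])
         (rule DERIV_continuous_on[OF has_field_derivative_at_within[OF G]])
    have deriv: "((\<lambda>t. G (arcsin t)) has_vector_derivative ?f t) (at t)" if "t \<in> {c<..<d}" for t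
    proof -
      from that cd have t: "-1 < t" "t < 1" by auto
      then have "t\<^sup>2 < 1" by (simp add: abs_square_less_1)
      then have s: "sqrt (1 - t\<^sup>2) \<noteq> 0" by simp
      have "((\<lambda>t. G (arcsin t)) has_real_derivative
          sin (arcsin t) ^ n * arcsin t ^ q * cos (arcsin t) * inverse (sqrt (1 - t\<^sup>2))) (at t)"
        by (rule DERIV_chain2[OF G DERIV_arcsin]) (use t in simp_all)
      also have "sin (arcsin t) ^ n * arcsin t ^ q * cos (arcsin t) * inverse (sqrt (1 - t\<^sup>2)) = ?f t"
        using t s by (simp add: cos_arcsin)
      finally show ?thesis by (simp add: has_real_derivative_iff_has_vector_derivative)
    qed
    \<comment> \<open>The derivative of \<open>arcsin\<close> blows up at -1 and 1, so this version
      asks for it only in the open interval, with continuity up to the end points.\<close>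
    have "(?f has_integral G (arcsin d) - G (arcsin c)) {c..d}"
      by (rule fundamental_theorem_of_calculus_interior[OF \<open>c \<le> d\<close> contG deriv])
    moreover have "set_integrable lborel {c..d} ?f"
      by (intro borel_integrable_atLeastAtMost' continuous_intros cont)
    ultimately show ?thesis
      using interval_integral_eq_integral[of c d ?f, OF \<open>c \<le> d\<close>]
      by (simp only: integral_unique)
  qed
  show ?thesis
  proof (cases "0 \<le> x")
    case True
    then show ?thesis using *[of 0 x] x \<open>G 0 = 0\<close>
      unfolding arcsin_integral_def zero_ereal_def by simp
  next
    case False
    then have "(LBINT t=x..0. ?f t) = - G (arcsin x)"
      using *[of x 0] x \<open>G 0 = 0\<close> unfolding zero_ereal_def by simp
    then show ?thesis
      unfolding arcsin_integral_def by (subst interval_integral_endpoints_reverse) simp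
  qed
qed

text \<open>Integration by parts with \<open>(sin u ^ Suc n - c) / Suc n\<close> as primitive of
  \<open>sin u ^ n * cos u\<close>. Taking the constant term \<open>c\<close> of the expansion as
  constant of integration leaves only integrals of \<open>u ^ r * f (m k * u)\<close>, which
  \<open>H\<close> supplies; rescaling the angle gives the factor \<open>1 / m k ^ Suc r\<close>.
  The parameters cover all four parity cases, with \<open>e\<close> a sign.\<close>

lemma arcsin_integral_multiple_angle:
  fixes b m :: "nat \<Rightarrow> real"
  assumes x: "\<bar>x\<bar> \<le> 1" and e: "e * e = 1"
    and m: "\<forall>k\<in>A. m k \<noteq> 0"
    and sum: "\<And>u. sin u ^ Suc n = c + 1 / Q * (\<Sum>k\<in>A. b k * f (m k * u))"
    and H: "\<And>z. (H has_real_derivative - (e * z ^ r / fact r * f z)) (at z)" and "H 0 = 0"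
  shows "arcsin_integral n (Suc r) x =
    (x ^ Suc n - c) * (arcsin x ^ Suc r / real (Suc n))
    + e * fact (Suc r) / (Q * real (Suc n))
      * (\<Sum>k\<in>A. b k * (1 / m k ^ Suc r) * H (m k * arcsin x))"
proof -
  \<comment> \<open>\<open>G\<close> is the claimed right-hand side as a function of the angle, so
    only its derivative and its value at 0 have to be checked.\<close>
  define G where "G u = (sin u ^ Suc n - c) * (u ^ Suc r / real (Suc n))
    + e * fact (Suc r) / (Q * real (Suc n)) * (\<Sum>k\<in>A. b k * (1 / m k ^ Suc r) * H (m k * u))" for u
  have summand: "((\<lambda>u. b k * (1 / m k ^ Suc r) * H (m k * u)) has_real_derivative
      - (e * u ^ r / fact r) * (b k * f (m k * u))) (at u)" if "k \<in> A" for k u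
  proof -
    have "((\<lambda>u. H (m k * u)) has_real_derivative
        - (e * (m k * u) ^ r / fact r * f (m k * u)) * m k) (at u)"
      by (rule DERIV_chain2[OF H]) (rule derivative_eq_intros refl | simp)+
    from DERIV_cmult[OF this, of "b k * (1 / m k ^ Suc r)"] show ?thesis
      by (rule DERIV_cong) (use bspec[OF m that] in \<open>simp add: field_simps power_mult_distrib\<close>)
  qed
  have "(G has_real_derivative sin u ^ n * u ^ Suc r * cos u) (at u)" for u
  proof -
    let ?S = "\<Sum>k\<in>A. b k * f (m k * u)"
    have 1: "((\<lambda>u. (sin u ^ Suc n - c) * (u ^ Suc r / real (Suc n))) has_real_derivative
        sin u ^ n * u ^ Suc r * cos u + (sin u ^ Suc n - c) * (real (Suc r) * u ^ r / real (Suc n))) (at u)"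
      by (rule derivative_eq_intros refl | simp)+
    have "((\<lambda>u. \<Sum>k\<in>A. b k * (1 / m k ^ Suc r) * H (m k * u)) has_real_derivative
        - (e * u ^ r / fact r) * ?S) (at u)"
      unfolding sum_distrib_left by (rule DERIV_sum[OF summand])
    note 2 = DERIV_cmult[OF this, of "e * fact (Suc r) / (Q * real (Suc n))"]
    \<comment> \<open>The prefactor is made so that \<open>e * e = 1\<close> and
      \<open>fact (Suc r) / fact r = Suc r\<close> turn the derivative of the sum into minus the
      unwanted second term of \<open>1\<close>.\<close>
    have "e * fact (Suc r) / (Q * real (Suc n)) * (- (e * u ^ r / fact r) * ?S)
        = - ((e * e) * (real (Suc r) * u ^ r / real (Suc n)) * (1 / Q * ?S))"
      unfolding fact_Suc of_nat_mult using fact_nonzero[of r, where 'a = real]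
      by (simp add: divide_inverse mult_ac del: of_nat_Suc)
    also have "\<dots> = - ((sin u ^ Suc n - c) * (real (Suc r) * u ^ r / real (Suc n)))"
      unfolding sum e by (simp only: add_diff_cancel_left' mult_1_left mult_ac)
    finally have 3: "e * fact (Suc r) / (Q * real (Suc n)) * (- (e * u ^ r / fact r) * ?S)
        = - ((sin u ^ Suc n - c) * (real (Suc r) * u ^ r / real (Suc n)))" .
    show ?thesis
      unfolding G_def by (rule DERIV_cong[OF DERIV_add[OF 1 2]]) (simp only: 3 add.assoc right_minus add_0_right)
  qed
  moreover have "G 0 = 0" by (simp add: G_def \<open>H 0 = 0\<close>)
  ultimately have "arcsin_integral n (Suc r) x = G (arcsin x)"
    using x by (intro arcsin_integral_substitution)
  moreover have "sin (arcsin x) = x" using x by simp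
  ultimately show ?thesis by (simp only: G_def)
qed

section \<open>The four parity cases\<close>

theorem theorem2p1:
  fixes x a :: real
  assumes "\<bar>x\<bar> \<le> 1" and "a = arcsin x"
  shows
    "(\<forall>p l :: nat. arcsin_integral (2 * l) (2 * p + 1) x =
       x ^ (2 * l + 1) / real (2 * l + 1) * a ^ (2 * p + 1)
       + (-1) ^ p * fact (2 * p + 1) / (4 ^ l * real (2 * l + 1))
         * (\<Sum>k=0..l. real ((2 * l + 1) choose (l - k)) * (1 / real (2 * k + 1) ^ (2 * p + 1))
             * (sin_psum (int p - 1) (real (2 * k + 1) * a) * poly (cheb_T (2 * k + 1)) x
                + cos_psum p (real (2 * k + 1) * a) * poly (cheb_U (2 * k)) x * sqrt (1 - x ^ 2)
                - (-1) ^ k)))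
     \<and> (\<forall>p l :: nat. l \<ge> 1 \<longrightarrow> arcsin_integral (2 * l - 1) (2 * p + 1) x =
       (x ^ (2 * l) - real ((2 * l) choose l) / 4 ^ l) * (a ^ (2 * p + 1) / real (2 * l))
       + (-1) ^ p * fact (2 * p + 1) / (2 ^ (2 * l - 1) * real (2 * l))
         * (\<Sum>k=1..l. real ((2 * l) choose (l - k)) * (1 / real (2 * k) ^ (2 * p + 1))
             * (sin_psum (int p - 1) (real (2 * k) * a) * poly (cheb_T (2 * k)) x
                + cos_psum p (real (2 * k) * a) * poly (cheb_U (2 * k - 1)) x * sqrt (1 - x ^ 2))))
     \<and> (\<forall>p l :: nat. p \<ge> 1 \<longrightarrow> arcsin_integral (2 * l) (2 * p) x =
       x ^ (2 * l + 1) / real (2 * l + 1) * a ^ (2 * p)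
       + (-1) ^ p * fact (2 * p) / (4 ^ l * real (2 * l + 1))
         * (\<Sum>k=0..l. real ((2 * l + 1) choose (l - k)) * (1 / real (2 * k + 1) ^ (2 * p))
             * (cos_psum (p - 1) (real (2 * k + 1) * a) * poly (cheb_T (2 * k + 1)) x
                - sin_psum (int p - 1) (real (2 * k + 1) * a) * poly (cheb_U (2 * k)) x
                  * sqrt (1 - x ^ 2))))
     \<and> (\<forall>p l :: nat. p \<ge> 1 \<longrightarrow> l \<ge> 1 \<longrightarrow> arcsin_integral (2 * l - 1) (2 * p) x =
       (x ^ (2 * l) - real ((2 * l) choose l) / 4 ^ l) * (a ^ (2 * p) / real (2 * l))
       + (-1) ^ p * fact (2 * p) / (2 ^ (2 * l - 1) * real (2 * l))
         * (\<Sum>k=1..l. real ((2 * l) choose (l - k)) * (1 / real (2 * k) ^ (2 * p))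
             * (cos_psum (p - 1) (real (2 * k) * a) * poly (cheb_T (2 * k)) x
                - sin_psum (int p - 1) (real (2 * k) * a) * poly (cheb_U (2 * k - 1)) x
                  * sqrt (1 - x ^ 2)
                - (-1) ^ k)))"
proof -
  have sina: "sin a = x" and cosa: "cos a = sqrt (1 - x\<^sup>2)"
    using assms by (simp_all add: cos_arcsin abs_le_iff)
  have T_odd: "poly (cheb_T (2 * k + 1)) x = (-1) ^ k * sin (real (2 * k + 1) * a)"
    and T_even: "poly (cheb_T (2 * k)) x = (-1) ^ k * cos (real (2 * k) * a)" for k
    using poly_cheb_T_sin[of "2 * k + 1" a] poly_cheb_T_sin[of "2 * k" a]
    unfolding sina cos_odd_complement cos_even_complement by blast+
  \<comment> \<open>The factor \<open>w\<close> stands for the partial sum that precedes the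
    polynomial in each left-nested product of the goal.\<close>
  have U_even: "w * poly (cheb_U (2 * k)) x * sqrt (1 - x\<^sup>2)
      = (-1) ^ k * (w * cos (real (2 * k + 1) * a))" for k w
    using poly_cheb_U_sin[of "2 * k" a]
    unfolding sina cosa Suc_eq_plus1 sin_odd_complement by (simp add: mult.assoc)
  \<comment> \<open>At \<open>k = 0\<close> the truncated index \<open>2 * k - 1\<close> would be 0
    and the equation could fail, hence the restriction to positive \<open>k\<close>.\<close>
  have U_odd: "w * poly (cheb_U (2 * k - 1)) x * sqrt (1 - x\<^sup>2)
      = - ((-1) ^ k * (w * sin (real (2 * k) * a)))" if "k \<ge> 1" for k w
  proof -
    from that have "Suc (2 * k - 1) = 2 * k" by simp
    then show ?thesis
      using poly_cheb_U_sin[of "2 * k - 1" a]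
      unfolding sina cosa by (simp only: sin_even_complement mult.assoc) simp
  qed
  have sign: "(-1) ^ p * (-1) ^ p = (1::real)" for p
    by (simp flip: power_mult_distrib)
  have sin_odd: "sin u ^ Suc (2 * l) = 0 + 1 / 4 ^ l *
      (\<Sum>k=0..l. real ((2 * l + 1) choose (l - k)) * (-1) ^ k * sin (real (2 * k + 1) * u))"
    for l and u :: real
    using sin_power_odd[of u l] by simp
  have sin_even: "sin u ^ Suc (2 * l - 1) = real ((2 * l) choose l) / 4 ^ l + 1 / 2 ^ (2 * l - 1) *
      (\<Sum>k=1..l. real ((2 * l) choose (l - k)) * (-1) ^ k * cos (real (2 * k) * u))"
    if "l \<ge> 1" for l and u :: real
  proof -
    from that obtain j where j: "l = Suc j" by (cases l) auto
    have "(2::real) / 4 ^ l = 1 / 2 ^ (2 * l - 1)" "Suc (2 * l - 1) = 2 * l"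
      by (simp_all add: j power_mult)
    with sin_power_even[of u l] show ?thesis by (simp only:)
  qed
  \<comment> \<open>Here \<open>e\<close> is the sign \<open>(-1) ^ k\<close> of the Chebyshev
    values. Pulled out of the bracket, it becomes the sign of the coefficient in the sine expansion,
    and a separate \<open>(-1) ^ k\<close> becomes the constant 1 of the primitive.\<close>
  have distr1: "b * w * (s * (e * S) + e * c - e) = b * e * w * (s * S + c - 1)"
    and distr2: "b * w * (s * (e * C) + - (e * c)) = b * e * w * (s * C - c)"
    and distr3: "b * w * (s * (e * S) - e * c) = b * e * w * (s * S - c)"
    and distr4: "b * w * (s * (e * C) - - (e * c) - e) = b * e * w * (s * C + c - 1)"
    for b w s e c S C :: real
    by (simp_all add: algebra_simps)
  have odd_nz: "\<forall>k\<in>{0..l}. real (2 * k + 1) \<noteq> 0" for l by simp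
  have even_nz: "\<forall>k\<in>{1..l}. real (2 * k) \<noteq> 0" for l by simp
  note shape = diff_zero times_divide_eq_left times_divide_eq_right
  show ?thesis
  proof (intro conjI allI impI)
    fix p l :: nat
    have zero: "sin_psum (int p - 1) 0 * sin 0 + cos_psum p 0 * cos 0 - 1 = 0" by simp
    note arcsin_integral_multiple_angle
      [OF assms(1) sign[of p] odd_nz[of l] sin_odd[where l = l] primitive_power_even_sin[of p], OF, OF zero,
        folded assms(2), unfolded Suc_eq_plus1]
    then show "arcsin_integral (2 * l) (2 * p + 1) x =
       x ^ (2 * l + 1) / real (2 * l + 1) * a ^ (2 * p + 1)
       + (-1) ^ p * fact (2 * p + 1) / (4 ^ l * real (2 * l + 1))
         * (\<Sum>k=0..l. real ((2 * l + 1) choose (l - k)) * (1 / real (2 * k + 1) ^ (2 * p + 1))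
             * (sin_psum (int p - 1) (real (2 * k + 1) * a) * poly (cheb_T (2 * k + 1)) x
                + cos_psum p (real (2 * k + 1) * a) * poly (cheb_U (2 * k)) x * sqrt (1 - x ^ 2)
                - (-1) ^ k))"
      unfolding T_odd U_even distr1 by (simp only: shape)
  next
    fix p l :: nat
    assume l: "l \<ge> 1"
    then have Suc_l: "Suc (2 * l - 1) = 2 * l" by simp
    have zero: "sin_psum (int p - 1) 0 * cos 0 - cos_psum p 0 * sin 0 = 0" by simp
    \<comment> \<open>\<open>U_odd\<close> needs positive \<open>k\<close>, so the summands are
      rewritten under the range of summation.\<close>
    have summand: "real ((2 * l) choose (l - k)) * (1 / real (2 * k) ^ (2 * p + 1))
             * (sin_psum (int p - 1) (real (2 * k) * a) * poly (cheb_T (2 * k)) x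
                + cos_psum p (real (2 * k) * a) * poly (cheb_U (2 * k - 1)) x * sqrt (1 - x ^ 2)) =
        real ((2 * l) choose (l - k)) * (-1) ^ k * (1 / real (2 * k) ^ (2 * p + 1))
          * (sin_psum (int p - 1) (real (2 * k) * a) * cos (real (2 * k) * a)
             - cos_psum p (real (2 * k) * a) * sin (real (2 * k) * a))" if "k \<in> {1..l}" for k
      using that by (simp only: T_even U_odd atLeastAtMost_iff distr2)
    note arcsin_integral_multiple_angle
      [OF assms(1) sign[of p] even_nz[of l] sin_even[OF l] primitive_power_even_cos[of p], OF zero,
        folded assms(2), unfolded Suc_l, unfolded Suc_eq_plus1]
    then show "arcsin_integral (2 * l - 1) (2 * p + 1) x =
       (x ^ (2 * l) - real ((2 * l) choose l) / 4 ^ l) * (a ^ (2 * p + 1) / real (2 * l))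
       + (-1) ^ p * fact (2 * p + 1) / (2 ^ (2 * l - 1) * real (2 * l))
         * (\<Sum>k=1..l. real ((2 * l) choose (l - k)) * (1 / real (2 * k) ^ (2 * p + 1))
             * (sin_psum (int p - 1) (real (2 * k) * a) * poly (cheb_T (2 * k)) x
                + cos_psum p (real (2 * k) * a) * poly (cheb_U (2 * k - 1)) x * sqrt (1 - x ^ 2)))"
      by (simp only: summand cong: sum.cong)
  next
    fix p l :: nat
    assume "p \<ge> 1"
    \<comment> \<open>By parts, the exponent \<open>2 * p\<close> drops to the odd power
      \<open>2 * r + 1\<close>; the partial sums of index \<open>p - 1\<close> are those of index
      \<open>r\<close>.\<close>
    then obtain r where p: "p = Suc r" by (cases p) auto
    have Suc_r: "Suc (2 * r + 1) = 2 * Suc r" "int (Suc r) - 1 = int r" "Suc r - 1 = r" by simp_all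
    have zero: "cos_psum r 0 * sin 0 - sin_psum (int r) 0 * cos 0 = 0" by simp
    note arcsin_integral_multiple_angle
      [OF assms(1) sign[of "Suc r"] odd_nz[of l] sin_odd[where l = l] primitive_power_odd_sin[of r], OF, OF zero,
        folded assms(2), unfolded Suc_r]
    then show "arcsin_integral (2 * l) (2 * p) x =
       x ^ (2 * l + 1) / real (2 * l + 1) * a ^ (2 * p)
       + (-1) ^ p * fact (2 * p) / (4 ^ l * real (2 * l + 1))
         * (\<Sum>k=0..l. real ((2 * l + 1) choose (l - k)) * (1 / real (2 * k + 1) ^ (2 * p))
             * (cos_psum (p - 1) (real (2 * k + 1) * a) * poly (cheb_T (2 * k + 1)) x
                - sin_psum (int p - 1) (real (2 * k + 1) * a) * poly (cheb_U (2 * k)) x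
                  * sqrt (1 - x ^ 2)))"
      unfolding p Suc_r T_odd U_even distr3 by (simp only: shape Suc_eq_plus1)
  next
    fix p l :: nat
    assume "p \<ge> 1" and l: "l \<ge> 1"
    then obtain r where p: "p = Suc r" by (cases p) auto
    from l have Suc_l: "Suc (2 * l - 1) = 2 * l" by simp
    have Suc_r: "Suc (2 * r + 1) = 2 * Suc r" "int (Suc r) - 1 = int r" "Suc r - 1 = r" by simp_all
    have zero: "cos_psum r 0 * cos 0 + sin_psum (int r) 0 * sin 0 - 1 = 0" by simp
    have summand: "real ((2 * l) choose (l - k)) * (1 / real (2 * k) ^ (2 * Suc r))
             * (cos_psum r (real (2 * k) * a) * poly (cheb_T (2 * k)) x
                - sin_psum (int r) (real (2 * k) * a) * poly (cheb_U (2 * k - 1)) x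
                  * sqrt (1 - x ^ 2)
                - (-1) ^ k) =
        real ((2 * l) choose (l - k)) * (-1) ^ k * (1 / real (2 * k) ^ (2 * Suc r))
          * (cos_psum r (real (2 * k) * a) * cos (real (2 * k) * a)
             + sin_psum (int r) (real (2 * k) * a) * sin (real (2 * k) * a) - 1)" if "k \<in> {1..l}" for k
      using that by (simp only: T_even U_odd atLeastAtMost_iff distr4)
    note arcsin_integral_multiple_angle
      [OF assms(1) sign[of "Suc r"] even_nz[of l] sin_even[OF l] primitive_power_odd_cos[of r], OF zero,
        folded assms(2), unfolded Suc_l Suc_r]
    then show "arcsin_integral (2 * l - 1) (2 * p) x =
       (x ^ (2 * l) - real ((2 * l) choose l) / 4 ^ l) * (a ^ (2 * p) / real (2 * l))
       + (-1) ^ p * fact (2 * p) / (2 ^ (2 * l - 1) * real (2 * l))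
         * (\<Sum>k=1..l. real ((2 * l) choose (l - k)) * (1 / real (2 * k) ^ (2 * p))
             * (cos_psum (p - 1) (real (2 * k) * a) * poly (cheb_T (2 * k)) x
                - sin_psum (int p - 1) (real (2 * k) * a) * poly (cheb_U (2 * k - 1)) x
                  * sqrt (1 - x ^ 2)
                - (-1) ^ k))"
      unfolding p Suc_r by (simp only: summand cong: sum.cong)
  qed
qed

end
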